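(* Let $G$ be a countably infinite group and let $X$ be a countably infinite set. Then $G$ is A-separable if and only if, for a generic action $\sigma\in\mathrm{H}(G)$ of $G$ on $X$, the action of $G$ on every orbit $\sigma(G)x$ ($x\in X$) is amenable.
   Context: $\mathrm{Sub}(G)$ is the space of all subgroups of $G$ with the Chabauty topology; for countable discrete $G$ a basis is given by the sets $\{K\in \mathrm{Sub}(G) : K\cap\Omega = H\cap\Omega\}$, with $H\in\mathrm{Sub}(G)$ and $\Omega\subseteq G$ finite. An action of a countable discrete group $G$ on a set $Y$ is amenable if it satisfies either of the following equivalent conditions: (i) for every $\varepsilon>0$ and every finite $\Omega\subseteq G$ there is a finite nonempty set $F\subseteq Y$ with $|gF\,\Delta\,F|/|F|<\varepsilon$ for all $g\in\Omega$ (an $(\varepsilon,\Omega)$-Følner set); (ii) there is a finitely additive $G$-invariant probability measure on $Y$ (defined on all subsets of $Y$). A subgroup $K\le G$ is co-amenable if the action of $G$ on $G/K$ by left translation is amenable. The group $G$ is A-separable (amenably separable) if the set of co-amenable subgroups of $G$ is dense in $\mathrm{Sub}(G)$. $X!$ is the group of all permutations of $X$ with the topology of pointwise convergence, which has as a basis the sets $\{\tau\in X! : \tau a=\sigma a \text{ and } \tau^{-1}a=\sigma^{-1}a \text{ for all } a\in A\}$, with $\sigma\in X!$ and $A\subseteq X$ finite; it is a Polish group. $\mathrm{H}(G)=\mathrm{Hom}(G,X!)$ is the set of all actions of $G$ on $X$, a closed subset of $(X!)^{G}$ with the product topology, hence a Polish space; a basis of its topology is given by the sets $\{\sigma\in \mathrm{H}(G)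 : \sigma(s)a=\varphi(s)a \text{ for all } s\in S,\ a\in A\}$, with $\varphi\in\mathrm{H}(G)$ and $S\subseteq G$, $A\subseteq X$ finite. A subset of a Baire space is generic if it contains a countable intersection of dense open sets. A property holds for a generic action if it holds for all elements of some generic subset of $\mathrm{H}(G)$. *)

theory Defs
  imports
    "HOL-Analysis.Analysis"
    "HOL-Algebra.Group_Action"
    "HOL-Algebra.Left_Coset"
begin

text \<open>The Chabauty topology on the set of subgroups of a countable discrete group, generated by
  its standard basis (the sets below already form a basis, see \<open>openin_sub_topology\<close>).\<close>

definition sub_topology :: "('g, 'm) monoid_scheme \<Rightarrow> 'g set topology" where
  "sub_topology G = topology_generated_by
     {{K. subgroup K G \<and> K \<inter> \<Omega> = H \<inter> \<Omega>} | H \<Omega>. subgroup H G \<and> finite \<Omega> \<and> \<Omega> \<subseteq> carrier G}"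

text \<open>Amenability of an action \<open>\<phi>\<close> of \<open>G\<close> on \<open>Y\<close>, by the Folner condition.\<close>

definition amenable_action ::
    "('g, 'm) monoid_scheme \<Rightarrow> 'y set \<Rightarrow> ('g \<Rightarrow> 'y \<Rightarrow> 'y) \<Rightarrow> bool" where
  "amenable_action G Y \<phi> \<longleftrightarrow>
     (\<forall>\<epsilon>::real. \<forall>\<Omega>. \<epsilon> > 0 \<and> finite \<Omega> \<and> \<Omega> \<subseteq> carrier G \<longrightarrow>
        (\<exists>F. finite F \<and> F \<noteq> {} \<and> F \<subseteq> Y \<and>
             (\<forall>g\<in>\<Omega>. real (card (sym_diff (\<phi> g ` F) F)) / real (card F) < \<epsilon>)))"

definition coamenable :: "('g, 'm) monoid_scheme \<Rightarrow> 'g set \<Rightarrow> bool" where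
  "coamenable G K \<longleftrightarrow> subgroup K G \<and>
     amenable_action G (lcosets\<^bsub>G\<^esub> K) (\<lambda>g. \<lambda>C\<in>lcosets\<^bsub>G\<^esub> K. g <#\<^bsub>G\<^esub> C)"

definition A_separable :: "('g, 'm) monoid_scheme \<Rightarrow> bool" where
  "A_separable G \<longleftrightarrow>
     sub_topology G closure_of {K. coamenable G K} = topspace (sub_topology G)"

text \<open>Pointwise convergence on the permutations of \<open>X\<close>, i.e. the subspace topology from the power
  \<open>X\<^sup>X\<close> with \<open>X\<close> discrete. Elements of \<open>Bij X\<close> are extensional, as are the points of the
  product topology.\<close>

definition sym_topology :: "'x set \<Rightarrow> ('x \<Rightarrow> 'x) topology" where
  "sym_topology X =
     subtopology (product_topology (\<lambda>_. discrete_topology X) X) (carrier (BijGroup X))"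

text \<open>The space of actions of \<open>G\<close> on \<open>X\<close>. Homomorphisms are taken extensional, so that each action
  is represented by exactly one function.\<close>

definition actions :: "('g, 'm) monoid_scheme \<Rightarrow> 'x set \<Rightarrow> ('g \<Rightarrow> 'x \<Rightarrow> 'x) set" where
  "actions G X = hom G (BijGroup X) \<inter> extensional (carrier G)"

definition action_topology ::
    "('g, 'm) monoid_scheme \<Rightarrow> 'x set \<Rightarrow> ('g \<Rightarrow> 'x \<Rightarrow> 'x) topology" where
  "action_topology G X =
     subtopology (product_topology (\<lambda>_. sym_topology X) (carrier G)) (actions G X)"

definition generic_in :: "'a topology \<Rightarrow> 'a set \<Rightarrow> bool" where
  "generic_in T R \<longleftrightarrow> R \<subseteq> topspace T \<and>
     (\<exists>\<U>. countable \<U> \<and> (\<forall>U\<in>\<U>. openin T U \<and> T closure_of U = topspace T) \<and>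
          topspace T \<inter> \<Inter>\<U> \<subseteq> R)"

definition holds_for_generic_action ::
    "('g, 'm) monoid_scheme \<Rightarrow> 'x set \<Rightarrow> (('g \<Rightarrow> 'x \<Rightarrow> 'x) \<Rightarrow> bool) \<Rightarrow> bool" where
  "holds_for_generic_action G X P \<longleftrightarrow>
     (\<exists>R. generic_in (action_topology G X) R \<and> (\<forall>\<sigma>\<in>R. P \<sigma>))"

lemma openin_sub_topology:
  "openin (sub_topology G) U \<longleftrightarrow>
     U \<subseteq> {K. subgroup K G} \<and>
     (\<forall>H\<in>U. \<exists>\<Omega>. finite \<Omega> \<and> \<Omega> \<subseteq> carrier G \<and> {K. subgroup K G \<and> K \<inter> \<Omega> = H \<inter> \<Omega>} \<subseteq> U)"
proof -
  define N where "N H \<Omega> = {K. subgroup K G \<and> K \<inter> \<Omega> = H \<inter> \<Omega>}" for H \<Omega>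
  define Fin where "Fin \<Omega> \<longleftrightarrow> finite \<Omega> \<and> \<Omega> \<subseteq> carrier G" for \<Omega>
  define R where "R V \<longleftrightarrow> (\<forall>H\<in>V. subgroup H G \<and> (\<exists>\<Omega>. Fin \<Omega> \<and> N H \<Omega> \<subseteq> V))" for V
  have top: "sub_topology G = topology_generated_by {N H \<Omega> | H \<Omega>. subgroup H G \<and> Fin \<Omega>}"
    by (simp add: sub_topology_def N_def Fin_def)
  have N_mono: "N H (\<Omega> \<union> \<Omega>') \<subseteq> N H \<Omega> \<inter> N H \<Omega>'" for H \<Omega> \<Omega>'
    unfolding N_def by blast
  have N_self: "H \<in> N H \<Omega>" if "subgroup H G" for H \<Omega>
    using that by (simp add: N_def)
  have N_eq: "N K \<Omega> = N H \<Omega>" if "K \<in> N H \<Omega>" for K H \<Omega>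
    using that by (simp add: N_def)
  have R1: "R V" if "generate_topology_on {N H \<Omega> | H \<Omega>. subgroup H G \<and> Fin \<Omega>} V" for V
    using that
  proof induction
    case Empty
    show ?case by (simp add: R_def)
  next
    case (Int a b)
    show ?case unfolding R_def
    proof (intro ballI conjI)
      fix H assume H: "H \<in> a \<inter> b"
      show "subgroup H G" using Int.IH(1) H by (simp add: R_def)
      obtain \<Omega> where 1: "Fin \<Omega>" "N H \<Omega> \<subseteq> a" using Int.IH(1) H unfolding R_def by blast
      obtain \<Omega>' where 2: "Fin \<Omega>'" "N H \<Omega>' \<subseteq> b" using Int.IH(2) H unfolding R_def by blast
      have "Fin (\<Omega> \<union> \<Omega>')" using 1 2 by (simp add: Fin_def)
      moreover have "N H (\<Omega> \<union> \<Omega>') \<subseteq> a \<inter> b" using N_mono[of H \<Omega> \<Omega>'] 1(2) 2(2) by blast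
      ultimately show "\<exists>\<Omega>. Fin \<Omega> \<and> N H \<Omega> \<subseteq> a \<inter> b" by blast
    qed
  next
    case (UN \<K>)
    show ?case unfolding R_def
    proof (intro ballI conjI)
      fix H assume "H \<in> \<Union>\<K>"
      then obtain k where k: "k \<in> \<K>" "H \<in> k" by blast
      then have "R k" using UN.IH by blast
      with k(2) show "subgroup H G" by (simp add: R_def)
      obtain \<Omega> where "Fin \<Omega>" "N H \<Omega> \<subseteq> k" using \<open>R k\<close> k(2) unfolding R_def by blast
      moreover have "k \<subseteq> \<Union>\<K>" using k(1) by (rule Union_upper)
      ultimately show "\<exists>\<Omega>. Fin \<Omega> \<and> N H \<Omega> \<subseteq> \<Union>\<K>" by (meson order_trans)
    qed
  next
    case (Basis s)
    then obtain H \<Omega> where s: "s = N H \<Omega>" "Fin \<Omega>" by blast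
    show ?case unfolding R_def
    proof (intro ballI conjI)
      fix K assume K: "K \<in> s"
      then show "subgroup K G" by (simp add: s N_def)
      have "N K \<Omega> \<subseteq> s" using N_eq K s(1) by simp
      with s(2) show "\<exists>\<Omega>. Fin \<Omega> \<and> N K \<Omega> \<subseteq> s" by blast
    qed
  qed
  have R2: "openin (sub_topology G) V" if V: "R V" for V
  proof (subst openin_subopen, rule ballI)
    fix H assume H: "H \<in> V"
    then obtain \<Omega> where o: "subgroup H G" "Fin \<Omega>" "N H \<Omega> \<subseteq> V" using V unfolding R_def by blast
    then have "openin (sub_topology G) (N H \<Omega>)"
      unfolding top by (intro topology_generated_by_Basis) blast
    then show "\<exists>T. openin (sub_topology G) T \<and> H \<in> T \<and> T \<subseteq> V"
      using o N_self by blast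
  qed
  have "openin (sub_topology G) U \<longleftrightarrow> R U"
  proof
    assume "openin (sub_topology G) U"
    then show "R U" unfolding top openin_topology_generated_by_iff by (rule R1)
  qed (rule R2)
  also have "R U \<longleftrightarrow> U \<subseteq> {K. subgroup K G} \<and> (\<forall>H\<in>U. \<exists>\<Omega>. Fin \<Omega> \<and> N H \<Omega> \<subseteq> U)"
    by (auto simp: R_def)
  finally show ?thesis by (simp only: N_def Fin_def conj_assoc)
qed

lemma topspace_sub_topology: "topspace (sub_topology G) = {K. subgroup K G}"
proof (rule subset_antisym)
  show "topspace (sub_topology G) \<subseteq> {K. subgroup K G}"
    using iffD1[OF openin_sub_topology openin_topspace] by (rule conjunct1)
  have "openin (sub_topology G) {K. subgroup K G}"
    unfolding openin_sub_topology
    by (intro conjI ballI exI[of _ "{}"]) auto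
  then show "{K. subgroup K G} \<subseteq> topspace (sub_topology G)"
    by (rule openin_subset)
qed

lemma topspace_sym_topology: "topspace (sym_topology X) = Bij X"
proof -
  have "Bij X \<subseteq> (\<Pi>\<^sub>E x\<in>X. X)"
    by (auto simp: Bij_def bij_betw_def PiE_def)
  then show ?thesis
    by (simp add: sym_topology_def BijGroup_def topspace_subtopology inf.absorb2)
qed

lemma topspace_action_topology: "topspace (action_topology G X) = actions G X"
proof -
  have "actions G X \<subseteq> (\<Pi>\<^sub>E g\<in>carrier G. Bij X)"
    by (auto simp: actions_def hom_def BijGroup_def PiE_def)
  then show ?thesis
    by (simp add: action_topology_def topspace_subtopology topspace_sym_topology inf.absorb2)
qed

lemma openin_action_topology:
  "openin (action_topology G X) U \<longleftrightarrow>
     U \<subseteq> actions G X \<and>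
     (\<forall>\<phi>\<in>U. \<exists>S A. finite S \<and> S \<subseteq> carrier G \<and> finite A \<and> A \<subseteq> X \<and>
        {\<sigma> \<in> actions G X. \<forall>s\<in>S. \<forall>a\<in>A. \<sigma> s a = \<phi> s a} \<subseteq> U)"
proof (intro iffI conjI ballI)
  let ?P = "product_topology (\<lambda>_. sym_topology X) (carrier G)"
  let ?Q = "product_topology (\<lambda>_. discrete_topology X) X"
  assume U: "openin (action_topology G X) U"
  then show UX: "U \<subseteq> actions G X"
    using openin_subset topspace_action_topology by metis
  fix \<phi> assume "\<phi> \<in> U"
  obtain W where W: "openin ?P W" "U = W \<inter> actions G X"
    using U by (auto simp: action_topology_def openin_subtopology)
  with \<open>\<phi> \<in> U\<close> have "\<phi> \<in> W" by blast
  obtain V where V: "finite {i \<in> carrier G. V i \<noteq> topspace (sym_topology X)}"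
      "\<forall>i\<in>carrier G. openin (sym_topology X) (V i)" "\<phi> \<in> Pi\<^sub>E (carrier G) V"
      "Pi\<^sub>E (carrier G) V \<subseteq> W"
    using W(1) \<open>\<phi> \<in> W\<close> unfolding openin_product_topology_alt by meson
  define S where "S = {i \<in> carrier G. V i \<noteq> topspace (sym_topology X)}"
  have ex: "\<exists>A. finite A \<and> A \<subseteq> X \<and> (\<forall>\<tau>\<in>Bij X. (\<forall>a\<in>A. \<tau> a = \<phi> s a) \<longrightarrow> \<tau> \<in> V s)"
    if s: "s \<in> carrier G" for s
  proof -
    obtain T where T: "openin ?Q T" "V s = T \<inter> Bij X"
      using V(2) s by (auto simp: sym_topology_def BijGroup_def openin_subtopology)
    have p: "\<phi> s \<in> V s" using V(3) s by (rule PiE_mem)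
    then have "\<phi> s \<in> T" using T by blast
    then obtain Y where Y: "finite {i \<in> X. Y i \<noteq> X}" "\<phi> s \<in> Pi\<^sub>E X Y" "Pi\<^sub>E X Y \<subseteq> T"
      using T(1) unfolding openin_product_topology_alt topspace_discrete_topology by meson
    have "\<tau> \<in> V s" if \<tau>: "\<tau> \<in> Bij X" "\<forall>a\<in>{i \<in> X. Y i \<noteq> X}. \<tau> a = \<phi> s a" for \<tau>
    proof -
      have "\<tau> i \<in> Y i" if i: "i \<in> X" for i
      proof (cases "Y i = X")
        case True
        then show ?thesis using Bij_imp_funcset[OF \<tau>(1)] i by auto
      next
        case False
        then have "\<tau> i = \<phi> s i" using \<tau>(2) i by simp
        then show ?thesis using PiE_mem[OF Y(2) i] by simp
      qed
      moreover have "\<tau> \<in> extensional X" using \<tau>(1) by (rule Bij_imp_extensional)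
      ultimately have "\<tau> \<in> Pi\<^sub>E X Y" by (simp add: PiE_iff)
      then show ?thesis using Y(3) T(2) \<tau>(1) by blast
    qed
    then show ?thesis using Y(1) by (intro exI[of _ "{i \<in> X. Y i \<noteq> X}"]) simp
  qed
  then obtain A where A: "\<And>s. s \<in> carrier G \<Longrightarrow>
      finite (A s) \<and> A s \<subseteq> X \<and> (\<forall>\<tau>\<in>Bij X. (\<forall>a\<in>A s. \<tau> a = \<phi> s a) \<longrightarrow> \<tau> \<in> V s)"
    by metis
  have SG: "S \<subseteq> carrier G" and fS: "finite S" using V(1) by (auto simp: S_def)
  have "\<sigma> \<in> U"
    if \<sigma>: "\<sigma> \<in> actions G X" and eq: "\<forall>s\<in>S. \<forall>a\<in>\<Union>(A ` S). \<sigma> s a = \<phi> s a" for \<sigma>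
  proof -
    have B: "\<sigma> s \<in> Bij X" if "s \<in> carrier G" for s
      using \<sigma> that by (auto simp: actions_def hom_def BijGroup_def)
    have "\<sigma> s \<in> V s" if s: "s \<in> carrier G" for s
    proof (cases "s \<in> S")
      case True
      then have "\<forall>a\<in>A s. \<sigma> s a = \<phi> s a" using eq by blast
      then show ?thesis using A[OF s] B[OF s] by blast
    next
      case False
      then have "V s = Bij X" using s by (simp add: S_def topspace_sym_topology)
      then show ?thesis using B[OF s] by simp
    qed
    then have "\<sigma> \<in> Pi\<^sub>E (carrier G) V" using \<sigma> by (simp add: PiE_iff actions_def)
    then show ?thesis using V(4) W(2) \<sigma> by blast
  qed
  then have "{\<sigma> \<in> actions G X. \<forall>s\<in>S. \<forall>a\<in>\<Union>(A ` S). \<sigma> s a = \<phi> s a} \<subseteq> U" by blast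
  moreover have "finite (\<Union>(A ` S))" using fS A SG by (intro finite_UN_I) auto
  moreover have "\<Union>(A ` S) \<subseteq> X" using A SG by (intro UN_least) auto
  ultimately show "\<exists>S A. finite S \<and> S \<subseteq> carrier G \<and> finite A \<and> A \<subseteq> X \<and>
        {\<sigma> \<in> actions G X. \<forall>s\<in>S. \<forall>a\<in>A. \<sigma> s a = \<phi> s a} \<subseteq> U"
    using fS SG by (intro exI[of _ S] exI[of _ "\<Union>(A ` S)"]) simp
next
  assume R: "U \<subseteq> actions G X \<and>
     (\<forall>\<phi>\<in>U. \<exists>S A. finite S \<and> S \<subseteq> carrier G \<and> finite A \<and> A \<subseteq> X \<and>
        {\<sigma> \<in> actions G X. \<forall>s\<in>S. \<forall>a\<in>A. \<sigma> s a = \<phi> s a} \<subseteq> U)"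
  let ?N = "\<lambda>\<phi> s a. {\<sigma> \<in> actions G X. \<sigma> s a = \<phi> s a}"
  have sub: "openin (action_topology G X) (?N \<phi> s a)"
    if "s \<in> carrier G" "a \<in> X" "\<phi> \<in> actions G X" for \<phi> s a
  proof -
    have "continuous_map (action_topology G X) (sym_topology X) (\<lambda>\<sigma>. \<sigma> s)"
      unfolding action_topology_def
      by (intro continuous_map_from_subtopology continuous_map_product_projection that)
    moreover have "continuous_map (sym_topology X) (discrete_topology X) (\<lambda>\<tau>. \<tau> a)"
      unfolding sym_topology_def
      by (intro continuous_map_from_subtopology continuous_map_product_projection that)
    ultimately have c: "continuous_map (action_topology G X) (discrete_topology X) (\<lambda>\<sigma>. \<sigma> s a)"
      using continuous_map_compose[unfolded comp_def] by blast
    have "\<phi> s a \<in> X"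
      using c that by (auto simp: continuous_map_def topspace_action_topology Pi_iff)
    then have "openin (action_topology G X)
        {\<sigma> \<in> topspace (action_topology G X). \<sigma> s a \<in> {\<phi> s a}}"
      by (intro openin_continuous_map_preimage[OF c]) simp
    then show ?thesis by (simp add: topspace_action_topology)
  qed
  show "openin (action_topology G X) U"
  proof (subst openin_subopen, rule ballI)
    fix \<phi> assume \<phi>: "\<phi> \<in> U"
    then obtain S A where SA: "finite S" "S \<subseteq> carrier G" "finite A" "A \<subseteq> X"
        "{\<sigma> \<in> actions G X. \<forall>s\<in>S. \<forall>a\<in>A. \<sigma> s a = \<phi> s a} \<subseteq> U"
      using R by blast
    have \<phi>a: "\<phi> \<in> actions G X" using R \<phi> by blast
    define W where "W = topspace (action_topology G X) \<inter> (\<Inter>(s, a)\<in>S \<times> A. ?N \<phi> s a)"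
    have "openin (action_topology G X) W"
    proof (cases "S \<times> A = {}")
      case True
      then have "W = topspace (action_topology G X)" unfolding W_def by auto
      then show ?thesis by simp
    next
      case False
      have "openin (action_topology G X) (\<Inter>(s, a)\<in>S \<times> A. ?N \<phi> s a)"
      proof (rule openin_Inter)
        show "finite ((\<lambda>(s, a). ?N \<phi> s a) ` (S \<times> A))" using SA(1,3) by simp
        show "(\<lambda>(s, a). ?N \<phi> s a) ` (S \<times> A) \<noteq> {}" using False by blast
        fix Z assume "Z \<in> (\<lambda>(s, a). ?N \<phi> s a) ` (S \<times> A)"
        then obtain s a where "Z = ?N \<phi> s a" "s \<in> S" "a \<in> A" by auto
        moreover have "s \<in> carrier G" "a \<in> X" using calculation SA(2,4) by blast+
        ultimately show "openin (action_topology G X) Z" using sub \<phi>a by simp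
      qed
      then show ?thesis unfolding W_def by (intro openin_Int openin_topspace)
    qed
    moreover have "W = {\<sigma> \<in> actions G X. \<forall>s\<in>S. \<forall>a\<in>A. \<sigma> s a = \<phi> s a}"
      by (auto simp: W_def topspace_action_topology)
    ultimately show "\<exists>T. openin (action_topology G X) T \<and> \<phi> \<in> T \<and> T \<subseteq> U"
      using SA(5) \<phi>a by (intro exI[of _ W]) auto
  qed
qed

end

theory Submission
  imports Defs
begin

text \<open>Both properties say that something can be approximated on finitely many data, and the bridge is
  that an orbit \<open>\<sigma>(G)x\<close> is the coset space of the stabilizer of \<open>x\<close>, so that it is amenable exactly
  when the stabilizer is co-amenable (\<open>amenable_orbit_iff_coamenable_stabilizer\<close>). What has to be
  shown is that stabilizers and actions can be perturbed together. The tool is a family of model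
  actions: given subgroups \<open>K c\<close>, one for each \<open>c \<in> X\<close>, the group acts on the disjoint union of the
  coset spaces \<open>G / K c\<close>. The index set \<open>X\<close> makes this a countably infinite set, hence a copy of \<open>X\<close>,
  and the identification with \<open>X\<close> may be prescribed on finitely many points
  (\<open>coset_model_action\<close>).

  Suppose \<open>G\<close> is A-separable. For a point \<open>x\<close>, a tolerance and a finite subset of \<open>G\<close>, the actions
  that have a suitable Foelner set inside the orbit of \<open>x\<close> form an open set, since finitely many
  values of the action certify the Foelner set (\<open>openin_folner_actions\<close>). Countably many such sets
  cut out the actions all of whose orbits are amenable. They are dense, because already those
  actions are dense (\<open>actions_with_amenable_orbits_dense\<close>): to approximate \<open>\<phi>\<close> on finitely many
  points, replace the stabilizer \<open>H\<close> of a base point in each orbit by a co-amenable \<open>K\<close> that agrees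
  with \<open>H\<close> on a large finite set. Then \<open>G / K\<close> looks like \<open>G / H\<close> on the part that matters, and the
  model action built from these \<open>K\<close> can be identified with \<open>X\<close> so that it agrees with \<open>\<phi>\<close> there.

  Conversely, let \<open>H\<close> be a subgroup and \<open>\<Omega>\<close> a finite set. Some action on \<open>X\<close> has a point \<open>x\<close> with
  stabilizer \<open>H\<close>. The space of actions is completely metrizable, being closed in a countable power
  of a discrete space, so by the Baire category theorem generic sets are dense
  (\<open>generic_action_dense\<close>). A generic action that moves \<open>x\<close> in the same way under the elements of
  \<open>\<Omega>\<close> has an amenable orbit through \<open>x\<close>, and the stabilizer of \<open>x\<close> is then a co-amenable subgroup
  that agrees with \<open>H\<close> on \<open>\<Omega>\<close>.\<close>

section \<open>Transport of amenability\<close>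

text \<open>An equivariant bijection carries Foelner sets to Foelner sets of the same quality.\<close>

lemma amenable_action_transfer:
  assumes f: "bij_betw f Y Z"
    and eq: "\<And>g y. g \<in> carrier G \<Longrightarrow> y \<in> Y \<Longrightarrow> f (\<phi> g y) = \<psi> g (f y)"
    and inv: "\<And>g y. g \<in> carrier G \<Longrightarrow> y \<in> Y \<Longrightarrow> \<phi> g y \<in> Y"
    and am: "amenable_action G Y \<phi>"
  shows "amenable_action G Z \<psi>"
  unfolding amenable_action_def
proof (intro allI impI)
  fix \<epsilon> :: real and \<Omega>
  assume \<Omega>: "\<epsilon> > 0 \<and> finite \<Omega> \<and> \<Omega> \<subseteq> carrier G"
  then obtain F where F: "finite F" "F \<noteq> {}" "F \<subseteq> Y"
      "\<forall>g\<in>\<Omega>. real (card (sym_diff (\<phi> g ` F) F)) / real (card F) < \<epsilon>"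
    using am unfolding amenable_action_def by meson
  have inj: "inj_on f Y" using f by (simp add: bij_betw_def)
  have "real (card (sym_diff (\<psi> g ` f ` F) (f ` F))) / real (card (f ` F)) < \<epsilon>"
    if g: "g \<in> \<Omega>" for g
  proof -
    have gc: "g \<in> carrier G" using g \<Omega> by blast
    have sub: "\<phi> g ` F \<subseteq> Y" using inv[OF gc] F(3) by blast
    have "\<psi> g ` f ` F = f ` \<phi> g ` F"
      using eq[OF gc] F(3) by (force simp: image_image)
    then have "sym_diff (\<psi> g ` f ` F) (f ` F) = f ` sym_diff (\<phi> g ` F) F"
      using inj_on_image_set_diff[OF inj, of "\<phi> g ` F" F]
        inj_on_image_set_diff[OF inj, of F "\<phi> g ` F"] sub F(3)
      by (metis Diff_subset dual_order.trans image_Un)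
    moreover have "card (f ` sym_diff (\<phi> g ` F) F) = card (sym_diff (\<phi> g ` F) F)"
      by (rule card_image, rule inj_on_subset[OF inj]) (use sub F(3) in blast)
    moreover have "card (f ` F) = card F"
      by (rule card_image, rule inj_on_subset[OF inj F(3)])
    ultimately show ?thesis using F(4) g by simp
  qed
  then show "\<exists>F. finite F \<and> F \<noteq> {} \<and> F \<subseteq> Z \<and>
      (\<forall>g\<in>\<Omega>. real (card (sym_diff (\<psi> g ` F) F)) / real (card F) < \<epsilon>)"
    using F f by (intro exI[of _ "f ` F"]) (auto simp: bij_betw_def)
qed

lemma amenable_action_cong_bij:
  assumes f: "bij_betw f Y Z"
    and eq: "\<And>g y. g \<in> carrier G \<Longrightarrow> y \<in> Y \<Longrightarrow> f (\<phi> g y) = \<psi> g (f y)"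
    and inv: "\<And>g y. g \<in> carrier G \<Longrightarrow> y \<in> Y \<Longrightarrow> \<phi> g y \<in> Y"
  shows "amenable_action G Y \<phi> \<longleftrightarrow> amenable_action G Z \<psi>"
proof
  assume "amenable_action G Y \<phi>"
  then show "amenable_action G Z \<psi>" using amenable_action_transfer f eq inv by blast
next
  assume am: "amenable_action G Z \<psi>"
  let ?h = "inv_into Y f"
  have h: "?h z \<in> Y" "f (?h z) = z" if "z \<in> Z" for z
    using f that by (auto simp: bij_betw_def inv_into_into f_inv_into_f)
  have 1: "\<psi> g z \<in> Z" if "g \<in> carrier G" "z \<in> Z" for g z
    using eq[of g "?h z"] inv[of g "?h z"] h[of z] that f by (metis bij_betwE)
  have 2: "?h (\<psi> g z) = \<phi> g (?h z)" if "g \<in> carrier G" "z \<in> Z" for g z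
    using eq[of g "?h z"] inv[of g "?h z"] h[of z] that f
    by (metis bij_betw_inv_into_left)
  show "amenable_action G Y \<phi>"
    using amenable_action_transfer[OF bij_betw_inv_into[OF f] _ _ am, of \<phi>] 1 2 by blast
qed

lemma (in group_action) orbit_subset: "x \<in> E \<Longrightarrow> orbit G \<phi> x \<subseteq> E"
  using element_image by (auto simp: orbit_def)

lemma (in group_action) orbit_closed:
  assumes "x \<in> E" "g \<in> carrier G" "y \<in> orbit G \<phi> x"
  shows "\<phi> g y \<in> orbit G \<phi> x"
proof -
  interpret G: group G using group_hom by (simp add: group_hom_def)
  obtain h where "h \<in> carrier G" "y = \<phi> h x" using assms(3) by (auto simp: orbit_def)
  then have "\<phi> g y = \<phi> (g \<otimes> h) x" "g \<otimes> h \<in> carrier G"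
    using composition_rule assms by simp_all
  then show ?thesis unfolding orbit_def by blast
qed

lemma (in group_action) fibre_eq_l_coset:
  assumes x: "x \<in> E" and t: "t \<in> carrier G"
  shows "{g \<in> carrier G. \<phi> g x = \<phi> t x} = t <# stabilizer G \<phi> x"
proof -
  interpret G: group G using group_hom by (simp add: group_hom_def)
  have "g \<in> t <# stabilizer G \<phi> x" if g: "g \<in> carrier G" "\<phi> g x = \<phi> t x" for g
  proof -
    have "\<phi> (inv t \<otimes> g) x = x"
      using composition_rule[OF x, of "inv t" g] orbit_sym_aux[OF t x] g t by simp
    then have "inv t \<otimes> g \<in> stabilizer G \<phi> x" using g t by (simp add: stabilizer_def)
    moreover have "g = t \<otimes> (inv t \<otimes> g)" using g t by (simp add: G.m_assoc[symmetric])
    ultimately show ?thesis unfolding l_coset_def by blast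
  qed
  moreover have "g \<in> carrier G \<and> \<phi> g x = \<phi> t x" if g: "g \<in> t <# stabilizer G \<phi> x" for g
  proof -
    obtain k where "k \<in> carrier G" "\<phi> k x = x" "g = t \<otimes> k"
      using g by (auto simp: l_coset_def stabilizer_def)
    then show ?thesis using composition_rule[OF x t] t by simp
  qed
  ultimately show ?thesis by blast
qed

lemma (in group_action) l_coset_stabilizer_eq_iff:
  assumes x: "x \<in> E" and s: "s \<in> carrier G" and t: "t \<in> carrier G"
  shows "s <# stabilizer G \<phi> x = t <# stabilizer G \<phi> x \<longleftrightarrow> \<phi> s x = \<phi> t x"
proof
  assume "s <# stabilizer G \<phi> x = t <# stabilizer G \<phi> x"
  then have "{g \<in> carrier G. \<phi> g x = \<phi> s x} = {g \<in> carrier G. \<phi> g x = \<phi> t x}"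
    using fibre_eq_l_coset[OF x s] fibre_eq_l_coset[OF x t] by simp
  moreover have "s \<in> {g \<in> carrier G. \<phi> g x = \<phi> s x}" using s by simp
  ultimately show "\<phi> s x = \<phi> t x" by simp
next
  assume "\<phi> s x = \<phi> t x"
  then show "s <# stabilizer G \<phi> x = t <# stabilizer G \<phi> x"
    using fibre_eq_l_coset[OF x s] fibre_eq_l_coset[OF x t] by simp
qed

text \<open>The orbit of \<open>x\<close> is equivariantly the space of left cosets of its stabilizer; the isomorphism
  sends a point of the orbit to the set of group elements that carry \<open>x\<close> there.\<close>

lemma (in group_action) amenable_orbit_iff_coamenable_stabilizer:
  assumes x: "x \<in> E"
  shows "amenable_action G (orbit G \<phi> x) (\<lambda>g. restrict (\<phi> g) (orbit G \<phi> x)) \<longleftrightarrow>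
    coamenable G (stabilizer G \<phi> x)"
proof -
  interpret G: group G using group_hom by (simp add: group_hom_def)
  let ?K = "stabilizer G \<phi> x" and ?O = "orbit G \<phi> x"
  let ?f = "\<lambda>y. {g \<in> carrier G. \<phi> g x = y}"
  have K: "subgroup ?K G" using stabilizer_subgroup[OF x] .
  have f: "?f (\<phi> t x) = t <# ?K" if "t \<in> carrier G" for t
    using fibre_eq_l_coset[OF x that] .
  have "inj_on ?f ?O"
    unfolding inj_on_def orbit_def by blast
  moreover have "?f ` ?O = lcosets ?K"
    using f by (fastforce simp: orbit_def LCOSETS_def image_iff)
  ultimately have bij: "bij_betw ?f ?O (lcosets ?K)" by (simp add: bij_betw_def)
  have "amenable_action G ?O (\<lambda>g. restrict (\<phi> g) ?O) \<longleftrightarrow>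
      amenable_action G (lcosets ?K) (\<lambda>g. \<lambda>C\<in>lcosets ?K. g <# C)"
  proof (rule amenable_action_cong_bij[OF bij])
    fix g y assume g: "g \<in> carrier G" and y: "y \<in> ?O"
    then obtain t where t: "t \<in> carrier G" "y = \<phi> t x" by (auto simp: orbit_def)
    have "?f (\<phi> g y) = g <# ?f y"
      using f[of "g \<otimes> t"] f[of t] g t composition_rule[OF x g t(1)]
        G.lcos_m_assoc[OF stabilizer_subset g t(1)] by simp
    moreover have "?f y \<in> lcosets ?K" using bij y by (blast dest: bij_betwE)
    ultimately show "?f (restrict (\<phi> g) ?O y) = (\<lambda>C\<in>lcosets ?K. g <# C) (?f y)"
      using y by simp
    show "restrict (\<phi> g) ?O y \<in> ?O" using orbit_closed[OF x g y] y by simp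
  qed
  then show ?thesis using K by (simp add: coamenable_def)
qed

section \<open>The space of actions is a Baire space\<close>

lemma (in group) actions_imp_group_action:
  assumes "\<sigma> \<in> actions G X"
  shows "group_action G X \<sigma>"
  using assms group_BijGroup[of X] is_group
  by (simp add: actions_def group_action_def group_hom_def group_hom_axioms_def)

text \<open>Invertibility of each \<open>\<sigma> g\<close> is automatic from the two equations, which only involve values of
  \<open>\<sigma>\<close>. This is what makes the space of actions closed among all families of maps \<open>X \<rightarrow> X\<close>, whereas for
  infinite \<open>X\<close> the bijections are not closed among the maps.\<close>

lemma (in group) actions_iff:
  "\<sigma> \<in> actions G X \<longleftrightarrow>
     \<sigma> \<in> (\<Pi>\<^sub>E g\<in>carrier G. \<Pi>\<^sub>E x\<in>X. X) \<and> (\<forall>x\<in>X. \<sigma> \<one> x = x) \<and>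
     (\<forall>g\<in>carrier G. \<forall>h\<in>carrier G. \<forall>x\<in>X. \<sigma> (g \<otimes> h) x = \<sigma> g (\<sigma> h x))"
proof
  assume \<sigma>: "\<sigma> \<in> actions G X"
  interpret group_action G X \<sigma> using actions_imp_group_action[OF \<sigma>] .
  have "\<sigma> \<in> (\<Pi>\<^sub>E g\<in>carrier G. \<Pi>\<^sub>E x\<in>X. X)"
  proof (rule PiE_I)
    show "\<sigma> g \<in> (\<Pi>\<^sub>E x\<in>X. X)" if "g \<in> carrier G" for g
      using bij_prop0[OF that, THEN Bij_imp_funcset] bij_prop0[OF that, THEN Bij_imp_extensional]
      by (simp add: PiE_def)
    show "\<sigma> g = undefined" if "g \<notin> carrier G" for g
      using \<sigma> that by (auto simp: actions_def extensional_def)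
  qed
  moreover have "\<forall>x\<in>X. \<sigma> \<one> x = x" using id_eq_one by (metis restrict_apply')
  ultimately show "\<sigma> \<in> (\<Pi>\<^sub>E g\<in>carrier G. \<Pi>\<^sub>E x\<in>X. X) \<and> (\<forall>x\<in>X. \<sigma> \<one> x = x) \<and>
     (\<forall>g\<in>carrier G. \<forall>h\<in>carrier G. \<forall>x\<in>X. \<sigma> (g \<otimes> h) x = \<sigma> g (\<sigma> h x))"
    using composition_rule by blast
next
  assume R: "\<sigma> \<in> (\<Pi>\<^sub>E g\<in>carrier G. \<Pi>\<^sub>E x\<in>X. X) \<and> (\<forall>x\<in>X. \<sigma> \<one> x = x) \<and>
     (\<forall>g\<in>carrier G. \<forall>h\<in>carrier G. \<forall>x\<in>X. \<sigma> (g \<otimes> h) x = \<sigma> g (\<sigma> h x))"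
  have B: "\<sigma> g \<in> Bij X" if g: "g \<in> carrier G" for g
  proof -
    have "\<sigma> (inv g) (\<sigma> g x) = x" "\<sigma> g (\<sigma> (inv g) x) = x" if "x \<in> X" for x
      using R g that by (metis inv_closed l_inv, metis inv_closed r_inv)
    moreover have "\<sigma> h \<in> X \<rightarrow> X" if "h \<in> carrier G" for h using R that by (auto simp: PiE_iff)
    ultimately have "bij_betw (\<sigma> g) X X"
      using g by (intro bij_betwI[where g = "\<sigma> (inv g)"]) simp_all
    then show ?thesis using R g by (auto simp: Bij_def PiE_iff)
  qed
  have "\<sigma> (g \<otimes> h) = compose X (\<sigma> g) (\<sigma> h)" if "g \<in> carrier G" "h \<in> carrier G" for g h
  proof (rule extensionalityI[of _ X])
    show "\<sigma> (g \<otimes> h) \<in> extensional X" using B that Bij_imp_extensional by blast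
    show "compose X (\<sigma> g) (\<sigma> h) \<in> extensional X" by simp
    show "\<sigma> (g \<otimes> h) x = compose X (\<sigma> g) (\<sigma> h) x" if "x \<in> X" for x
      using R that \<open>g \<in> carrier G\<close> \<open>h \<in> carrier G\<close> by (simp add: compose_eq)
  qed
  then show "\<sigma> \<in> actions G X"
    using R B by (auto simp: actions_def hom_def BijGroup_def PiE_iff)
qed

text \<open>A countable power of a discrete space is completely metrizable, and each of the equations in
  \<open>actions_iff\<close> defines a closed subset of it.\<close>

lemma (in group) completely_metrizable_action_topology:
  assumes "countable (carrier G)" "countable X"
  shows "completely_metrizable_space (action_topology G X)"
proof -
  define Q where "Q = product_topology (\<lambda>_. discrete_topology X) X"
  define P where "P = product_topology (\<lambda>_. Q) (carrier G)"
  have PiE: "actions G X \<subseteq> (\<Pi>\<^sub>E g\<in>carrier G. Bij X)"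
    by (auto simp: actions_def hom_def BijGroup_def PiE_def)
  have "action_topology G X = subtopology (subtopology P (\<Pi>\<^sub>E g\<in>carrier G. Bij X)) (actions G X)"
    by (simp add: action_topology_def sym_topology_def P_def Q_def BijGroup_def
        subtopology_product_topology)
  also have "\<dots> = subtopology P (actions G X)"
    using PiE by (simp add: subtopology_subtopology inf.absorb2)
  finally have top: "action_topology G X = subtopology P (actions G X)" .
  have tP: "topspace P = (\<Pi>\<^sub>E g\<in>carrier G. \<Pi>\<^sub>E x\<in>X. X)"
    by (simp add: P_def Q_def)
  have "countable {x \<in> X. \<nexists>a. topspace (discrete_topology X) \<subseteq> {a}}"
    by (rule countable_subset[OF _ assms(2)]) blast
  then have Q: "completely_metrizable_space Q"
    unfolding Q_def completely_metrizable_space_product_topology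
    using completely_metrizable_space_discrete_topology by blast
  have "countable {g \<in> carrier G. \<nexists>a. topspace Q \<subseteq> {a}}"
    by (rule countable_subset[OF _ assms(1)]) blast
  then have cP: "completely_metrizable_space P"
    unfolding P_def completely_metrizable_space_product_topology using Q by blast
  have ev: "continuous_map P (discrete_topology X) (\<lambda>\<sigma>. \<sigma> g x)"
    if "g \<in> carrier G" "x \<in> X" for g x
  proof -
    have "continuous_map P Q (\<lambda>\<sigma>. \<sigma> g)"
      unfolding P_def by (intro continuous_map_product_projection that)
    moreover have "continuous_map Q (discrete_topology X) (\<lambda>\<tau>. \<tau> x)"
      unfolding Q_def by (intro continuous_map_product_projection that)
    ultimately show ?thesis using continuous_map_compose[unfolded comp_def] by blast
  qed
  define C1 where "C1 x = {\<sigma> \<in> topspace P. \<sigma> \<one> x \<in> {x}}" for x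
  \<comment> \<open>The inner value \<open>y\<close> of \<open>\<sigma> g (\<sigma> h x)\<close> is made a parameter, so that each condition concerns
    finitely many fixed coordinates of \<open>\<sigma>\<close>.\<close>
  define C2 where "C2 g h x y = {\<sigma> \<in> topspace P. \<sigma> h x \<in> X - {y}} \<union>
      {\<sigma> \<in> topspace P. \<sigma> (g \<otimes> h) x = \<sigma> g y}" for g h x y
  have c1: "closedin P (C1 x)" if "x \<in> X" for x
    unfolding C1_def using that by (intro closedin_continuous_map_preimage[OF ev]) auto
  have c2: "closedin P (C2 g h x y)"
    if "g \<in> carrier G" "h \<in> carrier G" "x \<in> X" "y \<in> X" for g h x y
    unfolding C2_def using that
    by (intro closedin_Un closedin_continuous_map_preimage[OF ev]
        closedin_continuous_maps_eq[OF _ ev ev]) (auto simp: Hausdorff_space_discrete_topology)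
  let ?\<C> = "insert (topspace P) (C1 ` X \<union>
      (\<lambda>(g, h, x, y). C2 g h x y) ` (carrier G \<times> carrier G \<times> X \<times> X))"
  have "closedin P (\<Inter>?\<C>)"
    by (rule closedin_Inter) (use c1 c2 in auto)
  also have "\<Inter>?\<C> = actions G X"
  proof (rule Set.set_eqI)
    fix \<sigma>
    have val: "\<sigma> h x \<in> X" if "\<sigma> \<in> topspace P" "h \<in> carrier G" "x \<in> X" for h x
      using that unfolding tP by (auto simp: PiE_iff)
    show "\<sigma> \<in> \<Inter>?\<C> \<longleftrightarrow> \<sigma> \<in> actions G X"
    proof
      assume \<sigma>: "\<sigma> \<in> \<Inter>?\<C>"
      then have t: "\<sigma> \<in> topspace P" by blast
      have "\<sigma> \<one> x = x" if "x \<in> X" for x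
      proof -
        have "\<sigma> \<in> C1 x" using \<sigma> that by blast
        then show ?thesis by (simp add: C1_def)
      qed
      moreover have "\<sigma> (g \<otimes> h) x = \<sigma> g (\<sigma> h x)"
        if "g \<in> carrier G" "h \<in> carrier G" "x \<in> X" for g h x
      proof -
        have "(g, h, x, \<sigma> h x) \<in> carrier G \<times> carrier G \<times> X \<times> X"
          using that val[OF t] by simp
        then have "(\<lambda>(g, h, x, y). C2 g h x y) (g, h, x, \<sigma> h x) \<in> ?\<C>" by blast
        from InterD[OF \<sigma> this] have "\<sigma> \<in> C2 g h x (\<sigma> h x)" by simp
        then show ?thesis by (auto simp: C2_def)
      qed
      ultimately show "\<sigma> \<in> actions G X" using t unfolding actions_iff tP by blast
    next
      assume "\<sigma> \<in> actions G X"
      then show "\<sigma> \<in> \<Inter>?\<C>" using val unfolding actions_iff tP[symmetric]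
        by (auto simp: C1_def C2_def)
    qed
  qed
  finally have "closedin P (actions G X)" .
  then show ?thesis unfolding top using completely_metrizable_space_closedin[OF cP] by blast
qed

lemma (in group) generic_action_dense:
  assumes "countable (carrier G)" "countable X"
    and R: "generic_in (action_topology G X) R"
  shows "action_topology G X closure_of R = topspace (action_topology G X)"
proof -
  let ?T = "action_topology G X"
  obtain \<U> where \<U>: "countable \<U>" "\<forall>U\<in>\<U>. openin ?T U \<and> ?T closure_of U = topspace ?T"
      "topspace ?T \<inter> \<Inter>\<U> \<subseteq> R"
    using R by (auto simp: generic_in_def)
  have "?T closure_of \<Inter>\<U> = topspace ?T"
    using Baire_category[of ?T \<U>] completely_metrizable_action_topology[OF assms(1,2)] \<U>(1,2)
    by blast
  then have "topspace ?T = ?T closure_of (topspace ?T \<inter> \<Inter>\<U>)"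
    by (metis closure_of_restrict)
  also have "\<dots> \<subseteq> ?T closure_of R" using \<U>(3) by (rule closure_of_mono)
  finally show ?thesis using closure_of_subset_topspace by (metis subset_antisym)
qed

section \<open>Density in terms of finite data\<close>

lemma dense_in_action_topology:
  "action_topology G X closure_of U = topspace (action_topology G X) \<longleftrightarrow>
     (\<forall>\<phi>\<in>actions G X. \<forall>S A. finite S \<and> S \<subseteq> carrier G \<and> finite A \<and> A \<subseteq> X \<longrightarrow>
        (\<exists>\<sigma>\<in>U \<inter> actions G X. \<forall>s\<in>S. \<forall>a\<in>A. \<sigma> s a = \<phi> s a))" (is "?L \<longleftrightarrow> ?R")
proof
  assume L: ?L
  show ?R
  proof (intro ballI allI impI)
    fix \<phi> S A
    assume \<phi>: "\<phi> \<in> actions G X" and SA: "finite S \<and> S \<subseteq> carrier G \<and> finite A \<and> A \<subseteq> X"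
    let ?N = "{\<sigma> \<in> actions G X. \<forall>s\<in>S. \<forall>a\<in>A. \<sigma> s a = \<phi> s a}"
    have "openin (action_topology G X) ?N"
      unfolding openin_action_topology
    proof (intro conjI ballI)
      fix \<psi> assume "\<psi> \<in> ?N"
      then show "\<exists>S A. finite S \<and> S \<subseteq> carrier G \<and> finite A \<and> A \<subseteq> X \<and>
          {\<sigma> \<in> actions G X. \<forall>s\<in>S. \<forall>a\<in>A. \<sigma> s a = \<psi> s a} \<subseteq> ?N"
        using SA by (intro exI[of _ S] exI[of _ A]) simp
    qed simp
    moreover have "?N \<noteq> {}" using \<phi> by blast
    ultimately have "U \<inter> ?N \<noteq> {}" using L unfolding dense_intersects_open by blast
    then show "\<exists>\<sigma>\<in>U \<inter> actions G X. \<forall>s\<in>S. \<forall>a\<in>A. \<sigma> s a = \<phi> s a" by blast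
  qed
next
  assume R: ?R
  show ?L unfolding dense_intersects_open
  proof (intro allI impI)
    fix T assume T: "openin (action_topology G X) T \<and> T \<noteq> {}"
    then obtain \<phi> where \<phi>: "\<phi> \<in> T" by blast
    then obtain S A where SA: "finite S \<and> S \<subseteq> carrier G \<and> finite A \<and> A \<subseteq> X"
        "{\<sigma> \<in> actions G X. \<forall>s\<in>S. \<forall>a\<in>A. \<sigma> s a = \<phi> s a} \<subseteq> T"
      using T unfolding openin_action_topology by meson
    have "\<phi> \<in> actions G X" using T \<phi> unfolding openin_action_topology by blast
    then obtain \<sigma> where "\<sigma> \<in> U \<inter> actions G X" "\<forall>s\<in>S. \<forall>a\<in>A. \<sigma> s a = \<phi> s a"
      using R[rule_format, OF _ SA(1)] by meson
    then show "U \<inter> T \<noteq> {}" using SA(2) by blast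
  qed
qed

lemma A_separable_iff:
  "A_separable G \<longleftrightarrow>
     (\<forall>H \<Omega>. subgroup H G \<and> finite \<Omega> \<and> \<Omega> \<subseteq> carrier G \<longrightarrow> (\<exists>K. coamenable G K \<and> K \<inter> \<Omega> = H \<inter> \<Omega>))"
  (is "?L \<longleftrightarrow> ?R")
proof
  assume L: ?L
  show ?R
  proof (intro allI impI)
    fix H \<Omega> assume *: "subgroup H G \<and> finite \<Omega> \<and> \<Omega> \<subseteq> carrier G"
    let ?N = "{K. subgroup K G \<and> K \<inter> \<Omega> = H \<inter> \<Omega>}"
    have "openin (sub_topology G) ?N"
      unfolding sub_topology_def using * by (intro topology_generated_by_Basis) blast
    moreover have "?N \<noteq> {}" using * by blast
    ultimately have "{K. coamenable G K} \<inter> ?N \<noteq> {}"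
      using L unfolding A_separable_def dense_intersects_open by blast
    then show "\<exists>K. coamenable G K \<and> K \<inter> \<Omega> = H \<inter> \<Omega>" by blast
  qed
next
  assume R: ?R
  show ?L unfolding A_separable_def dense_intersects_open
  proof (intro allI impI)
    fix T assume T: "openin (sub_topology G) T \<and> T \<noteq> {}"
    then obtain H where H: "H \<in> T" by blast
    then obtain \<Omega> where \<Omega>: "finite \<Omega> \<and> \<Omega> \<subseteq> carrier G" "{K. subgroup K G \<and> K \<inter> \<Omega> = H \<inter> \<Omega>} \<subseteq> T"
      using T unfolding openin_sub_topology by meson
    have "subgroup H G" using T H unfolding openin_sub_topology by blast
    then obtain K where "coamenable G K" "K \<inter> \<Omega> = H \<inter> \<Omega>"
      using R[rule_format, of H \<Omega>] \<Omega>(1) by meson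
    then show "{K. coamenable G K} \<inter> T \<noteq> {}" using \<Omega>(2) by (auto simp: coamenable_def)
  qed
qed

section \<open>Actions assembled from coset spaces\<close>

text \<open>Removing finite sets from both sides leaves two countably infinite sets, which can be matched
  arbitrarily.\<close>

lemma bij_betw_extending_finite:
  assumes "countable X" "infinite X" "countable M" "infinite M"
    and A: "finite A" "A \<subseteq> X" and j: "inj_on j A" "j ` A \<subseteq> M"
  obtains b where "bij_betw b X M" "\<And>a. a \<in> A \<Longrightarrow> b a = j a"
proof -
  obtain f :: "nat \<Rightarrow> _" where f: "bij_betw f UNIV (X - A)"
    using assms by (meson Diff_infinite_finite countable_Diff countable_infiniteE')
  obtain h :: "nat \<Rightarrow> _" where h: "bij_betw h UNIV (M - j ` A)"
    using assms by (meson Diff_infinite_finite countable_Diff countable_infiniteE' finite_imageI)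
  have k: "bij_betw (h \<circ> inv_into UNIV f) (X - A) (M - j ` A)"
    using bij_betw_trans[OF bij_betw_inv_into[OF f] h] .
  have "bij_betw (\<lambda>x. if x \<in> A then j x else (h \<circ> inv_into UNIV f) x)
      (A \<union> (X - A)) (j ` A \<union> (M - j ` A))"
    using j by (intro bij_betw_disjoint_Un k) (auto simp: bij_betw_def)
  then have "bij_betw (\<lambda>x. if x \<in> A then j x else (h \<circ> inv_into UNIV f) x) X M"
    using A j by (simp add: Un_absorb1)
  then show thesis by (rule that) simp
qed

lemma (in group) l_coset_in_lcosets:
  assumes "subgroup K G" "C \<in> lcosets K" "g \<in> carrier G"
  shows "g <# C \<in> lcosets K"
proof -
  obtain t where "t \<in> carrier G" "C = t <# K" using assms(2) by (auto simp: LCOSETS_def)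
  then have "g <# C = (g \<otimes> t) <# K" "g \<otimes> t \<in> carrier G"
    using lcos_m_assoc[OF subgroup.subset[OF assms(1)] assms(3)] assms(3) by simp_all
  then show ?thesis unfolding LCOSETS_def by blast
qed

lemma (in group) l_coset_eq_iff:
  assumes "subgroup K G" "s \<in> carrier G" "t \<in> carrier G"
  shows "s <# K = t <# K \<longleftrightarrow> inv t \<otimes> s \<in> K"
proof
  assume "s <# K = t <# K"
  then have "s \<in> t <# K" using lcos_self[OF assms(2,1)] by simp
  then show "inv t \<otimes> s \<in> K" using subgroup.lcos_module_imp[OF assms(1) is_group assms(3)] by blast
next
  assume "inv t \<otimes> s \<in> K"
  moreover have "s = t \<otimes> (inv t \<otimes> s)" using assms by (simp add: m_assoc[symmetric])
  ultimately have "s \<in> t <# K" unfolding l_coset_def by blast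
  then show "s <# K = t <# K" using l_repr_independence[OF _ assms(3,1)] by simp
qed

text \<open>The translation action on the disjoint union of the \<open>G / K c\<close>, transported to \<open>X\<close> by a
  bijection \<open>b\<close>. Indexing by all of \<open>X\<close> guarantees infinitely many orbits, so that the union is
  infinite even if every coset space is finite. Prescribing \<open>b\<close> on \<open>A\<close> is the only freedom that is
  needed to make the new action agree with a given one on finitely many values.\<close>

lemma (in group) coset_model_action:
  fixes X :: "'x set"
  assumes cG: "countable (carrier G)" and X: "countable X" "infinite X"
    and K: "\<And>c. c \<in> X \<Longrightarrow> subgroup (K c) G"
    and A: "finite A" "A \<subseteq> X"
    and j: "inj_on j A" "j ` A \<subseteq> (SIGMA c:X. lcosets (K c))"
  shows "\<exists>\<sigma>\<in>actions G X. \<exists>b. bij_betw b X (SIGMA c:X. lcosets (K c)) \<and> (\<forall>a\<in>A. b a = j a) \<and>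
    (\<forall>g\<in>carrier G. \<forall>x\<in>X. b (\<sigma> g x) = (fst (b x), g <# snd (b x)))"
proof -
  let ?M = "SIGMA c:X. lcosets (K c)"
  have cM: "countable ?M"
    using X cG by (intro countable_SIGMA) (auto simp: LCOSETS_def)
  have "inj_on (\<lambda>c. (c, \<one> <# K c)) X" "(\<lambda>c. (c, \<one> <# K c)) ` X \<subseteq> ?M"
    by (auto simp: inj_on_def LCOSETS_def)
  then have iM: "infinite ?M" using X(2) finite_subset finite_imageD by metis
  obtain b where b: "bij_betw b X ?M" "\<And>a. a \<in> A \<Longrightarrow> b a = j a"
    using bij_betw_extending_finite[OF X cM iM A j] by blast
  define m where "m g p = (fst p, g <# snd p)" for g :: 'a and p :: "'x \<times> 'a set"
  (* the restrictions make \<sigma> the extensional representative that membership in actions requires *)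
  define \<sigma> where "\<sigma> = (\<lambda>g\<in>carrier G. \<lambda>x\<in>X. inv_into X b (m g (b x)))"
  have bM: "b x \<in> ?M" if "x \<in> X" for x using b(1) that by (blast dest: bij_betwE)
  have mM: "m g p \<in> ?M" if "g \<in> carrier G" "p \<in> ?M" for g p
    using that K l_coset_in_lcosets by (auto simp: m_def)
  have b\<sigma>: "b (\<sigma> g x) = m g (b x)" if "g \<in> carrier G" "x \<in> X" for g x
    using that mM[OF that(1) bM[OF that(2)]] b(1)
    by (simp add: \<sigma>_def bij_betw_inv_into_right)
  have \<sigma>X: "\<sigma> g x \<in> X" if "g \<in> carrier G" "x \<in> X" for g x
    using that mM[OF that(1) bM[OF that(2)]] b(1)
    by (simp add: \<sigma>_def bij_betw_def inv_into_into)
  have sub: "snd p \<subseteq> carrier G" if "p \<in> ?M" for p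
    using that subgroup.lcosets_carrier[OF K is_group, of "fst p" "snd p"] by auto
  have b_eqD: "x = y" if "b x = b y" "x \<in> X" "y \<in> X" for x y
    using inj_onD[OF bij_betw_imp_inj_on[OF b(1)] that] .
  have "\<sigma> \<in> actions G X"
    unfolding actions_iff
  proof (intro conjI ballI)
    show "\<sigma> \<in> (\<Pi>\<^sub>E g\<in>carrier G. \<Pi>\<^sub>E x\<in>X. X)"
      using \<sigma>X by (auto simp: PiE_iff \<sigma>_def)
    show "\<sigma> \<one> x = x" if x: "x \<in> X" for x
      by (rule b_eqD) (use x b\<sigma> \<sigma>X lcos_mult_one[OF sub[OF bM[OF x]]] in \<open>simp_all add: m_def\<close>)
    show "\<sigma> (g \<otimes> h) x = \<sigma> g (\<sigma> h x)"
      if gh: "g \<in> carrier G" "h \<in> carrier G" and x: "x \<in> X" for g h x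
      by (rule b_eqD)
        (use x gh b\<sigma> \<sigma>X lcos_m_assoc[OF sub[OF bM[OF x]] gh] in \<open>simp_all add: m_def\<close>)
  qed
  then show ?thesis
    using b b\<sigma> by (intro bexI[of _ \<sigma>] exI[of _ b]) (simp_all add: m_def)
qed

lemma (in group) coset_model_stabilizer:
  assumes K: "subgroup (K c) G"
    and b: "inj_on b X" and x: "x \<in> X" "b x = (c, K c)"
    and \<sigma>: "\<sigma> \<in> actions G X"
    and eq: "\<And>g x. g \<in> carrier G \<Longrightarrow> x \<in> X \<Longrightarrow> b (\<sigma> g x) = (fst (b x), g <# snd (b x))"
  shows "stabilizer G \<sigma> x = K c"
proof -
  interpret group_action G X \<sigma> using actions_imp_group_action[OF \<sigma>] .
  have "\<sigma> g x = x \<longleftrightarrow> g \<in> K c" if g: "g \<in> carrier G" for g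
  proof -
    have "\<sigma> g x = x \<longleftrightarrow> b (\<sigma> g x) = b x"
      using inj_on_eq_iff[OF b, of "\<sigma> g x" x] element_image[OF g x(1)] x(1) by blast
    also have "\<dots> \<longleftrightarrow> g <# K c = \<one> <# K c"
      using eq[OF g x(1)] x(2) lcos_mult_one[OF subgroup.subset[OF K]] by simp
    also have "\<dots> \<longleftrightarrow> g \<in> K c" using l_coset_eq_iff[OF K g one_closed] g by simp
    finally show ?thesis .
  qed
  then show ?thesis using subgroup.subset[OF K] by (auto simp: stabilizer_def)
qed

lemma (in group) coset_model_orbits_amenable:
  assumes K: "\<And>c. c \<in> X \<Longrightarrow> coamenable G (K c)"
    and b: "bij_betw b X (SIGMA c:X. lcosets (K c))"
    and \<sigma>: "\<sigma> \<in> actions G X"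
    and eq: "\<And>g x. g \<in> carrier G \<Longrightarrow> x \<in> X \<Longrightarrow> b (\<sigma> g x) = (fst (b x), g <# snd (b x))"
    and x: "x \<in> X"
  shows "amenable_action G (orbit G \<sigma> x) (\<lambda>g. restrict (\<sigma> g) (orbit G \<sigma> x))"
proof -
  interpret group_action G X \<sigma> using actions_imp_group_action[OF \<sigma>] .
  obtain c t where c: "c \<in> X" "t \<in> carrier G" "b x = (c, t <# K c)"
    using bij_betwE[OF b] x by (fastforce simp: LCOSETS_def)
  have Kc: "subgroup (K c) G" using K[OF c(1)] by (simp add: coamenable_def)
  \<comment> \<open>Moving \<open>x\<close> within its orbit to the trivial coset makes its stabilizer \<open>K c\<close> itself, rather
    than a conjugate.\<close>
  define x' where "x' = \<sigma> (inv t) x"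
  have x': "x' \<in> X" unfolding x'_def using element_image c(2) x by blast
  have "b x' = (c, K c)"
    unfolding x'_def using eq[of "inv t" x] c x subgroup.subset[OF Kc]
    by (simp add: lcos_m_assoc lcos_mult_one)
  then have "stabilizer G \<sigma> x' = K c"
    using coset_model_stabilizer[of K c b X x' \<sigma>, OF Kc _ x' _ \<sigma> eq] b by (simp add: bij_betw_def)
  then have am: "amenable_action G (orbit G \<sigma> x') (\<lambda>g. restrict (\<sigma> g) (orbit G \<sigma> x'))"
    using amenable_orbit_iff_coamenable_stabilizer[OF x'] K[OF c(1)] by simp
  have "x' \<in> orbit G \<sigma> x" using c(2) unfolding x'_def orbit_def by blast
  then have "orbit G \<sigma> x' = orbit G \<sigma> x"
    using orbit_trans[OF x x'] orbit_trans[OF x' x] orbit_sym[OF x x'] orbit_subset x x' by blast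
  then show ?thesis using am by simp
qed

section \<open>Density of actions with amenable orbits\<close>

text \<open>The points of \<open>A\<close> and their images under \<open>S\<close> are written as \<open>t y\<close> applied to a base point \<open>r y\<close>
  that depends only on the orbit. Every relation \<open>\<phi> s a = b\<close> among these points then says that a
  certain group element lies in the stabilizer of the base point. Only finitely many group
  elements arise, so a co-amenable \<open>K c\<close> that agrees with the stabilizer of \<open>c\<close> on them satisfies
  exactly the same relations. Hence sending \<open>y\<close> to the coset of \<open>t y\<close> in the component of \<open>r y\<close> is
  injective and respects the given values, and it extends to an identification of the model
  with \<open>X\<close>.\<close>

lemma (in group) actions_with_amenable_orbits_dense:
  assumes cG: "countable (carrier G)" and X: "countable X" "infinite X"
    and sep: "A_separable G"
    and \<phi>: "\<phi> \<in> actions G X"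
    and S: "finite S" "S \<subseteq> carrier G" and A: "finite A" "A \<subseteq> X"
  shows "\<exists>\<sigma>\<in>actions G X. (\<forall>s\<in>S. \<forall>a\<in>A. \<sigma> s a = \<phi> s a) \<and>
    (\<forall>x\<in>X. amenable_action G (orbit G \<sigma> x) (\<lambda>g. restrict (\<sigma> g) (orbit G \<sigma> x)))"
proof -
  interpret group_action G X \<phi> using actions_imp_group_action[OF \<phi>] .
  (* the choice depends on the orbit as a set, hence is constant along it *)
  define r where "r y = (SOME z. z \<in> orbit G \<phi> y)" for y
  have r_orb: "r y \<in> orbit G \<phi> y" if "y \<in> X" for y
    unfolding r_def using orbit_refl[OF that] by (rule someI)
  have rX: "r y \<in> X" if "y \<in> X" for y using r_orb orbit_subset that by blast
  have r_eq: "r (\<phi> g y) = r y" if "g \<in> carrier G" "y \<in> X" for g y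
  proof -
    have 1: "\<phi> g y \<in> orbit G \<phi> y" "\<phi> g y \<in> X"
      using that element_image unfolding orbit_def by blast+
    have "orbit G \<phi> (\<phi> g y) = orbit G \<phi> y"
      using orbit_trans[OF that(2) 1(2)] orbit_trans[OF 1(2) that(2)] orbit_sym[OF that(2) 1(2)]
        orbit_subset 1 that(2) by blast
    then show ?thesis by (simp add: r_def)
  qed
  have "\<exists>t\<in>carrier G. \<phi> t (r y) = y" if "y \<in> X" for y
    using orbit_sym[OF that rX[OF that] r_orb[OF that]] by (auto simp: orbit_def intro: sym)
  then obtain t where t: "\<And>y. y \<in> X \<Longrightarrow> t y \<in> carrier G" "\<And>y. y \<in> X \<Longrightarrow> \<phi> (t y) (r y) = y"
    by metis
  define A' where "A' = A \<union> (\<Union>s\<in>S. \<phi> s ` A)"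
  have A': "finite A'" "A' \<subseteq> X"
    unfolding A'_def using S A element_image[OF _ _ refl] by auto
  \<comment> \<open>Whether \<open>\<phi> s a = b\<close> is read off from membership of \<open>inv (t b) \<otimes> (s \<otimes> t a)\<close> in a stabilizer;
    \<open>s = \<one>\<close> separates the points of \<open>A'\<close>.\<close>
  define \<Omega> where "\<Omega> = (\<lambda>(b, s, a). inv (t b) \<otimes> (s \<otimes> t a)) ` (A' \<times> insert \<one> S \<times> A')"
  have \<Omega>: "finite \<Omega>" "\<Omega> \<subseteq> carrier G"
    unfolding \<Omega>_def using A' S t(1)[OF subsetD[OF A'(2)]] by auto
  have "\<exists>K. coamenable G K \<and> K \<inter> \<Omega> = stabilizer G \<phi> c \<inter> \<Omega>" if "c \<in> X" for c
    using sep[unfolded A_separable_iff, rule_format, of "stabilizer G \<phi> c" \<Omega>]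
      stabilizer_subgroup[OF that] \<Omega> by simp
  then obtain K where K: "\<And>c. c \<in> X \<Longrightarrow> coamenable G (K c)"
      "\<And>c. c \<in> X \<Longrightarrow> K c \<inter> \<Omega> = stabilizer G \<phi> c \<inter> \<Omega>"
    by metis
  have Ksub: "subgroup (K c) G" if "c \<in> X" for c using K(1)[OF that] by (simp add: coamenable_def)
  define j where "j a = (r a, t a <# K (r a))" for a
  have key: "(s \<otimes> t a) <# K (r a) = t b <# K (r a) \<longleftrightarrow> \<phi> s a = b"
    if s: "s \<in> insert \<one> S" and a: "a \<in> A'" and b: "b \<in> A'" and rb: "r b = r a" for s a b
  proof -
    have car: "a \<in> X" "b \<in> X" "s \<in> carrier G" "t a \<in> carrier G" "t b \<in> carrier G" "r a \<in> X"
      using s a b A' S t(1) rX by auto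
    have in\<Omega>: "inv (t b) \<otimes> (s \<otimes> t a) \<in> \<Omega>"
      unfolding \<Omega>_def using s a b by force
    have "(s \<otimes> t a) <# K (r a) = t b <# K (r a) \<longleftrightarrow> inv (t b) \<otimes> (s \<otimes> t a) \<in> K (r a)"
      using l_coset_eq_iff[OF Ksub] car by simp
    also have "\<dots> \<longleftrightarrow> inv (t b) \<otimes> (s \<otimes> t a) \<in> stabilizer G \<phi> (r a)"
      using K(2)[OF car(6)] in\<Omega> by blast
    also have "\<dots> \<longleftrightarrow> (s \<otimes> t a) <# stabilizer G \<phi> (r a) = t b <# stabilizer G \<phi> (r a)"
      using l_coset_eq_iff[OF stabilizer_subgroup] car by simp
    also have "\<dots> \<longleftrightarrow> \<phi> (s \<otimes> t a) (r a) = \<phi> (t b) (r a)"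
      using l_coset_stabilizer_eq_iff[OF car(6)] car by simp
    also have "\<dots> \<longleftrightarrow> \<phi> s a = b"
      using composition_rule[OF car(6) car(3,4)] t(2)[OF car(1)] t(2)[OF car(2)] rb by simp
    finally show ?thesis .
  qed
  have inj: "inj_on j A'"
  proof (rule inj_onI)
    fix a b assume ab: "a \<in> A'" "b \<in> A'" "j a = j b"
    then have "r b = r a" "(\<one> \<otimes> t a) <# K (r a) = t b <# K (r a)"
      using A' t(1) by (auto simp: j_def)
    then have "\<phi> \<one> a = b" using key[of \<one> a b] ab by blast
    then show "a = b" using ab(1) A' id_eq_one by (metis restrict_apply' subsetD)
  qed
  have img: "j ` A' \<subseteq> (SIGMA c:X. lcosets (K c))"
    using A' rX t(1) by (auto simp: j_def LCOSETS_def)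
  obtain \<sigma> b where \<sigma>: "\<sigma> \<in> actions G X"
    and b: "bij_betw b X (SIGMA c:X. lcosets (K c))" and bj: "\<And>a. a \<in> A' \<Longrightarrow> b a = j a"
    and eq: "\<And>g x. g \<in> carrier G \<Longrightarrow> x \<in> X \<Longrightarrow> b (\<sigma> g x) = (fst (b x), g <# snd (b x))"
    using coset_model_action[where K = K and j = j, OF cG X Ksub A' inj img] by blast
  interpret \<sigma>: group_action G X \<sigma> using actions_imp_group_action[OF \<sigma>] .
  have "\<sigma> s a = \<phi> s a" if s: "s \<in> S" and a: "a \<in> A" for s a
  proof -
    have car: "s \<in> carrier G" "a \<in> X" "t a \<in> carrier G" "r a \<in> X" using s a S A t(1) rX by auto
    have aA: "a \<in> A'" "\<phi> s a \<in> A'" using s a by (auto simp: A'_def)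
    have "b (\<sigma> s a) = (r a, (s \<otimes> t a) <# K (r a))"
      using eq[OF car(1,2)] bj[OF aA(1)] lcos_m_assoc[OF subgroup.subset[OF Ksub] car(1,3)] car(4)
      by (simp add: j_def)
    also have "\<dots> = b (\<phi> s a)"
      using bj[OF aA(2)] key[of s a "\<phi> s a"] s aA r_eq[OF car(1,2)] by (simp add: j_def)
    finally show ?thesis
      using b \<sigma>.element_image element_image car by (metis bij_betw_def inj_on_eq_iff)
  qed
  moreover have "amenable_action G (orbit G \<sigma> x) (\<lambda>g. restrict (\<sigma> g) (orbit G \<sigma> x))"
    if "x \<in> X" for x
    using coset_model_orbits_amenable[OF K(1) b \<sigma> eq that] .
  ultimately show ?thesis using \<sigma> by blast
qed

section \<open>Co-amenable subgroups as stabilizers\<close>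

text \<open>Whether \<open>s \<in> \<Omega>\<close> fixes \<open>x\<close> is decided by the value of the action at \<open>s\<close> and \<open>x\<close>, so actions near
  one whose stabilizer at \<open>x\<close> is \<open>H\<close> have stabilizers near \<open>H\<close>.\<close>

lemma (in group) A_separable_if_amenable_orbits_dense:
  assumes cG: "countable (carrier G)" and X: "countable X" "infinite X"
    and dense: "action_topology G X closure_of R = topspace (action_topology G X)"
    and R: "\<And>\<sigma> x. \<sigma> \<in> R \<Longrightarrow> x \<in> X \<Longrightarrow>
      amenable_action G (orbit G \<sigma> x) (\<lambda>g. restrict (\<sigma> g) (orbit G \<sigma> x))"
  shows "A_separable G"
proof -
  obtain x where x: "x \<in> X" using X(2) by fastforce
  show ?thesis
    unfolding A_separable_iff
  proof (intro allI impI)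
    fix H \<Omega> assume H: "subgroup H G \<and> finite \<Omega> \<and> \<Omega> \<subseteq> carrier G"
    have HH: "H \<in> lcosets H"
      using lcos_mult_one[OF subgroup.subset[of H G]] H by (force simp: LCOSETS_def)
    (* the model with K c = H for every c is X copies of G / H; x becomes the trivial coset in
       its own copy *)
    have "\<exists>\<phi>\<in>actions G X. \<exists>b. bij_betw b X (SIGMA c:X. lcosets H) \<and> (\<forall>a\<in>{x}. b a = (a, H)) \<and>
      (\<forall>g\<in>carrier G. \<forall>y\<in>X. b (\<phi> g y) = (fst (b y), g <# snd (b y)))"
      by (rule coset_model_action[OF cG X, of "\<lambda>_. H" "{x}" "\<lambda>a. (a, H)"])
        (use H HH x in auto)
    then obtain \<phi> b where \<phi>: "\<phi> \<in> actions G X" and b: "bij_betw b X (SIGMA c:X. lcosets H)"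
        "b x = (x, H)" "\<And>g y. g \<in> carrier G \<Longrightarrow> y \<in> X \<Longrightarrow> b (\<phi> g y) = (fst (b y), g <# snd (b y))"
      by blast
    have stab: "stabilizer G \<phi> x = H"
      using coset_model_stabilizer[of "\<lambda>_. H" x b X x \<phi>] H b \<phi> x by (simp add: bij_betw_def)
    obtain \<sigma> where \<sigma>: "\<sigma> \<in> R" "\<sigma> \<in> actions G X" "\<forall>s\<in>\<Omega>. \<forall>a\<in>{x}. \<sigma> s a = \<phi> s a"
      using dense[unfolded dense_in_action_topology] \<phi> H x
      by (metis IntE empty_subsetI finite.emptyI finite.insertI insert_subset)
    interpret group_action G X \<sigma> using actions_imp_group_action[OF \<sigma>(2)] .
    have "coamenable G (stabilizer G \<sigma> x)"
      using amenable_orbit_iff_coamenable_stabilizer[OF x] R[OF \<sigma>(1) x] by blast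
    moreover have "stabilizer G \<sigma> x \<inter> \<Omega> = H \<inter> \<Omega>"
      unfolding stab[symmetric] using \<sigma>(3) by (auto simp: stabilizer_def)
    ultimately show "\<exists>K. coamenable G K \<and> K \<inter> \<Omega> = H \<inter> \<Omega>" by blast
  qed
qed

section \<open>Foelner sets in orbits\<close>

text \<open>For \<open>F\<close> inside the orbit, restricting \<open>\<sigma> g\<close> to the orbit does not change \<open>\<sigma> g ` F\<close>; the
  unrestricted form lets the condition be read off from single values of \<open>\<sigma>\<close>.\<close>

definition folner_actions ::
    "('g, 'm) monoid_scheme \<Rightarrow> 'x set \<Rightarrow> 'x \<Rightarrow> real \<Rightarrow> 'g set \<Rightarrow> ('g \<Rightarrow> 'x \<Rightarrow> 'x) set" where
  "folner_actions G X x \<epsilon> \<Omega> = {\<sigma> \<in> actions G X. \<exists>F. finite F \<and> F \<noteq> {} \<and> F \<subseteq> orbit G \<sigma> x \<and>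
     (\<forall>g\<in>\<Omega>. real (card (sym_diff (\<sigma> g ` F) F)) / real (card F) < \<epsilon>)}"

text \<open>Tolerances of the form \<open>1 / Suc n\<close> suffice, which leaves countably many conditions when \<open>G\<close> is
  countable.\<close>

lemma amenable_orbit_iff_folner_actions:
  assumes "\<sigma> \<in> actions G X"
  shows "amenable_action G (orbit G \<sigma> x) (\<lambda>g. restrict (\<sigma> g) (orbit G \<sigma> x)) \<longleftrightarrow>
    (\<forall>n \<Omega>. finite \<Omega> \<and> \<Omega> \<subseteq> carrier G \<longrightarrow> \<sigma> \<in> folner_actions G X x (1 / real (Suc n)) \<Omega>)"
proof -
  have im: "restrict (\<sigma> g) (orbit G \<sigma> x) ` F = \<sigma> g ` F" if "F \<subseteq> orbit G \<sigma> x" for g F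
    using that by force
  have am: "amenable_action G (orbit G \<sigma> x) (\<lambda>g. restrict (\<sigma> g) (orbit G \<sigma> x)) \<longleftrightarrow>
    (\<forall>\<epsilon>>0. \<forall>\<Omega>. finite \<Omega> \<and> \<Omega> \<subseteq> carrier G \<longrightarrow> \<sigma> \<in> folner_actions G X x \<epsilon> \<Omega>)"
    using assms im unfolding amenable_action_def folner_actions_def by (simp cong: conj_cong) metis
  have mono: "\<sigma> \<in> folner_actions G X x \<epsilon> \<Omega>"
    if "\<sigma> \<in> folner_actions G X x \<delta> \<Omega>" "\<delta> < \<epsilon>" for \<delta> \<epsilon> \<Omega>
    using that unfolding folner_actions_def by fastforce
  show ?thesis unfolding am
  proof (intro iffI allI impI)
    fix n \<Omega> assume "\<forall>\<epsilon>>0. \<forall>\<Omega>. finite \<Omega> \<and> \<Omega> \<subseteq> carrier G \<longrightarrow> \<sigma> \<in> folner_actions G X x \<epsilon> \<Omega>"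
      "finite \<Omega> \<and> \<Omega> \<subseteq> carrier G"
    then show "\<sigma> \<in> folner_actions G X x (1 / real (Suc n)) \<Omega>" by simp
  next
    fix \<epsilon> :: real and \<Omega>
    assume *: "\<forall>n \<Omega>. finite \<Omega> \<and> \<Omega> \<subseteq> carrier G \<longrightarrow> \<sigma> \<in> folner_actions G X x (1 / real (Suc n)) \<Omega>"
      "0 < \<epsilon>" "finite \<Omega> \<and> \<Omega> \<subseteq> carrier G"
    obtain n where "1 / real (Suc n) < \<epsilon>" using nat_approx_posE[OF *(2)] by blast
    then show "\<sigma> \<in> folner_actions G X x \<epsilon> \<Omega>" using mono * by blast
  qed
qed

text \<open>A Foelner set \<open>F\<close> for \<open>\<phi>\<close> remains one for every \<open>\<sigma>\<close> that agrees with \<open>\<phi>\<close> in two respects: the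
  elements \<open>t y\<close> still carry \<open>x\<close> to the points of \<open>F\<close>, which keeps \<open>F\<close> inside the orbit of \<open>x\<close>, and
  the elements of \<open>\<Omega>\<close> still act on \<open>F\<close> in the same way.\<close>

lemma openin_folner_actions:
  assumes x: "x \<in> X" and \<Omega>: "finite \<Omega>" "\<Omega> \<subseteq> carrier G" and G: "group G"
  shows "openin (action_topology G X) (folner_actions G X x \<epsilon> \<Omega>)"
  unfolding openin_action_topology
proof (intro conjI ballI)
  show "folner_actions G X x \<epsilon> \<Omega> \<subseteq> actions G X" by (auto simp: folner_actions_def)
  fix \<phi> assume "\<phi> \<in> folner_actions G X x \<epsilon> \<Omega>"
  then obtain F where F: "finite F" "F \<noteq> {}" "F \<subseteq> orbit G \<phi> x"
      "\<forall>g\<in>\<Omega>. real (card (sym_diff (\<phi> g ` F) F)) / real (card F) < \<epsilon>"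
    and \<phi>: "\<phi> \<in> actions G X"
    by (auto simp: folner_actions_def)
  interpret group_action G X \<phi> using group.actions_imp_group_action[OF G \<phi>] .
  have "\<exists>g\<in>carrier G. \<phi> g x = y" if "y \<in> F" for y
    using F(3) that by (force simp: orbit_def)
  then obtain t where t: "\<And>y. y \<in> F \<Longrightarrow> t y \<in> carrier G" "\<And>y. y \<in> F \<Longrightarrow> \<phi> (t y) x = y"
    by metis
  have "\<sigma> \<in> folner_actions G X x \<epsilon> \<Omega>"
    if \<sigma>: "\<sigma> \<in> actions G X" and eq: "\<forall>s\<in>\<Omega> \<union> t ` F. \<forall>a\<in>insert x F. \<sigma> s a = \<phi> s a" for \<sigma>
  proof -
    have "\<sigma> (t y) x = y" if "y \<in> F" for y using eq t(2) that by simp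
    then have "F \<subseteq> orbit G \<sigma> x" using t(1) unfolding orbit_def by force
    moreover have "\<sigma> g ` F = \<phi> g ` F" if "g \<in> \<Omega>" for g using eq that by force
    ultimately show ?thesis using \<sigma> F unfolding folner_actions_def by auto
  qed
  then show "\<exists>S A. finite S \<and> S \<subseteq> carrier G \<and> finite A \<and> A \<subseteq> X \<and>
      {\<sigma> \<in> actions G X. \<forall>s\<in>S. \<forall>a\<in>A. \<sigma> s a = \<phi> s a} \<subseteq> folner_actions G X x \<epsilon> \<Omega>"
    using \<Omega> F(1,3) t(1) x orbit_subset[OF x]
    by (intro exI[of _ "\<Omega> \<union> t ` F"] exI[of _ "insert x F"]) auto
qed

theorem theorem1p3:
  fixes G :: "('g, 'm) monoid_scheme" and X :: "'x set"
  assumes "group G"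
    and "countable (carrier G)" and "infinite (carrier G)"
    and "countable X" and "infinite X"
  shows "A_separable G \<longleftrightarrow>
    holds_for_generic_action G X
      (\<lambda>\<sigma>. \<forall>x\<in>X. amenable_action G (orbit G \<sigma> x) (\<lambda>g. restrict (\<sigma> g) (orbit G \<sigma> x)))"
proof
  interpret group G by fact
  let ?T = "action_topology G X"
  define Good where "Good \<sigma> \<longleftrightarrow>
    (\<forall>x\<in>X. amenable_action G (orbit G \<sigma> x) (\<lambda>g. restrict (\<sigma> g) (orbit G \<sigma> x)))" for \<sigma>
  assume sep: "A_separable G"
  define I where "I = X \<times> (UNIV :: nat set) \<times> {\<Omega>. finite \<Omega> \<and> \<Omega> \<subseteq> carrier G}"
  define \<U> where "\<U> = (\<lambda>(x, n, \<Omega>). folner_actions G X x (1 / real (Suc n)) \<Omega>) ` I"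
  have "countable \<U>"
    unfolding \<U>_def I_def using countable_Collect_finite_subset[OF assms(2)] assms(4)
    by (intro countable_image countable_SIGMA) auto
  have good_iff: "\<sigma> \<in> \<Inter>\<U> \<longleftrightarrow> Good \<sigma>" if "\<sigma> \<in> actions G X" for \<sigma>
    using amenable_orbit_iff_folner_actions[OF that]
    by (auto simp: \<U>_def I_def Good_def)
  have dense: "?T closure_of U = topspace ?T" if U: "U \<in> \<U>" for U
    unfolding dense_in_action_topology
  proof (intro ballI allI impI)
    fix \<phi> S A
    assume "\<phi> \<in> actions G X" "finite S \<and> S \<subseteq> carrier G \<and> finite A \<and> A \<subseteq> X"
    then obtain \<sigma> where "\<sigma> \<in> actions G X" "\<forall>s\<in>S. \<forall>a\<in>A. \<sigma> s a = \<phi> s a" "Good \<sigma>"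
      using actions_with_amenable_orbits_dense[OF assms(2,4,5) sep, of \<phi> S A]
      unfolding Good_def by auto
    then show "\<exists>\<sigma>\<in>U \<inter> actions G X. \<forall>s\<in>S. \<forall>a\<in>A. \<sigma> s a = \<phi> s a" using good_iff U by blast
  qed
  have "openin ?T U" if "U \<in> \<U>" for U
    using that openin_folner_actions[OF _ _ _ is_group] by (auto simp: \<U>_def I_def)
  with dense \<open>countable \<U>\<close> have "generic_in ?T {\<sigma> \<in> actions G X. Good \<sigma>}"
    unfolding generic_in_def topspace_action_topology
    using good_iff by (intro conjI exI[of _ \<U>]) auto
  then show "holds_for_generic_action G X (\<lambda>\<sigma>. \<forall>x\<in>X.
      amenable_action G (orbit G \<sigma> x) (\<lambda>g. restrict (\<sigma> g) (orbit G \<sigma> x)))"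
    unfolding holds_for_generic_action_def Good_def by blast
next
  interpret group G by fact
  assume "holds_for_generic_action G X (\<lambda>\<sigma>. \<forall>x\<in>X.
      amenable_action G (orbit G \<sigma> x) (\<lambda>g. restrict (\<sigma> g) (orbit G \<sigma> x)))"
  then obtain R where R: "generic_in (action_topology G X) R"
    "\<And>\<sigma> x. \<sigma> \<in> R \<Longrightarrow> x \<in> X \<Longrightarrow>
      amenable_action G (orbit G \<sigma> x) (\<lambda>g. restrict (\<sigma> g) (orbit G \<sigma> x))"
    unfolding holds_for_generic_action_def by blast
  then show "A_separable G"
    using A_separable_if_amenable_orbits_dense[OF assms(2,4,5)] generic_action_dense[OF assms(2,4)]
    by blast
qed

end
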